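(* Let $0 < \alpha < 1$ and let $\mathscr{C}$ be a spherical $S^1(\alpha)$-code in $\mathbb{C}^r$ with Gram matrix $M = M_{\mathscr{C}}$ and $n = |\mathscr{C}|$. If $\lambda$ is an eigenvalue of $M$ with corresponding unit eigenvector $x$, then \[ \lambda \left(\frac{\lambda^2}{ \alpha^2 n + 1 - \alpha^2} - \frac{1-\alpha^2}{\alpha^2} \right) |x(u)|^2 \geq \lambda - \frac{1-\alpha^2}{\alpha^2} \] for all $u \in \mathscr{C}$, with equality if $n = r^2$.
   Context: $S^1(\alpha) = \{z \in \mathbb{C} : |z| = \alpha\}$. A spherical $S^1(\alpha)$-code in $\mathbb{C}^r$ is a finite set $\mathscr{C}$ of unit vectors in $\mathbb{C}^r$ with $|\langle u, v\rangle| = \alpha$ for all $u \neq v \in \mathscr{C}$, where $\langle u,v\rangle = u^* v$. Its Gram matrix $M_{\mathscr{C}} \in \mathbb{C}^{\mathscr{C}\times\mathscr{C}}$ has entries $M_{\mathscr{C}}(u,v) = \langle u, v\rangle$. Vectors in $\mathbb{C}^{\mathscr{C}}$ (such as the eigenvector $x$) are functions $\mathscr{C}\to\mathbb{C}$, with coordinates $x(u)$.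
   Formalization: Equality for n = r² is claimed only when λ ≠ 0; for λ = 0 the left side is 0 and the right side is −(1−α²)/α² < 0, so equality always fails (e.g. r = 2, n = 4, α = 1/√3, where 0 is an eigenvalue of M). *)

theory Defs
  imports "HOL-Analysis.Analysis"
begin

text \<open>The standard Hermitian inner product \<open>u\<^sup>* v\<close> on \<open>\<complex>\<^sup>r\<close> (modelled as \<open>complex ^ 'r\<close>
  with \<open>r = CARD('r)\<close>), conjugate-linear in the first argument. The library norm on this type is
  the one induced by it.\<close>

definition cinner :: "complex ^ 'r \<Rightarrow> complex ^ 'r \<Rightarrow> complex" where
  "cinner u v = (\<Sum>i\<in>UNIV. cnj (u $ i) * v $ i)"

definition spherical_code :: "real \<Rightarrow> (complex ^ 'r) set \<Rightarrow> bool" where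
  "spherical_code \<alpha> C \<longleftrightarrow>
     finite C \<and> (\<forall>u\<in>C. norm u = 1) \<and> (\<forall>u\<in>C. \<forall>v\<in>C. u \<noteq> v \<longrightarrow> cmod (cinner u v) = \<alpha>)"

text \<open>Matrices and vectors indexed by a finite set \<open>I\<close> are functions whose values outside \<open>I\<close>
  are irrelevant: every notion below only looks at indices in \<open>I\<close>. In particular the Gram matrix
  of a code \<open>C\<close> is \<open>gram_matrix\<close> read on \<open>C\<close>.\<close>

definition gram_matrix :: "complex ^ 'r \<Rightarrow> complex ^ 'r \<Rightarrow> complex" where
  "gram_matrix u v = cinner u v"

definition eigenvector_on :: "'a set \<Rightarrow> ('a \<Rightarrow> 'a \<Rightarrow> complex) \<Rightarrow> complex \<Rightarrow> ('a \<Rightarrow> complex) \<Rightarrow> bool" where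
  "eigenvector_on I M lam x \<longleftrightarrow>
     (\<exists>u\<in>I. x u \<noteq> 0) \<and> (\<forall>u\<in>I. (\<Sum>v\<in>I. M u v * x v) = lam * x u)"

definition unit_vector_on :: "'a set \<Rightarrow> ('a \<Rightarrow> complex) \<Rightarrow> bool" where
  "unit_vector_on I x \<longleftrightarrow> sqrt (\<Sum>u\<in>I. (cmod (x u))\<^sup>2) = 1"

end

theory Submission
  imports Defs
begin

text \<open>Put \<open>w = \<Sum>\<^sub>v x(v) v\<close>, so that \<open>v\<^sup>* w = \<lambda> x(v)\<close> and \<open>w\<^sup>* w = \<lambda>\<close>. In the space of
  \<open>r \<times> r\<close> matrices with the Frobenius inner product, the projections \<open>v v\<^sup>*\<close> have Gram matrix
  \<open>(1 - \<alpha>\<^sup>2) I + \<alpha>\<^sup>2 J\<close>, which is explicitly invertible. The inequality says that the orthogonal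
  projection of the rank-one matrix \<open>u w\<^sup>*\<close> onto their span is no longer than \<open>u w\<^sup>*\<close> itself.
  If \<open>n = r\<^sup>2\<close>, the projections form a basis of the whole space and equality holds.\<close>

section \<open>Inner products, rank-one matrices and orthogonal residuals\<close>

lemma cinner_sum_right: "cinner a (\<Sum>v\<in>S. f v) = (\<Sum>v\<in>S. cinner a (f v))"
  unfolding cinner_def by (simp add: sum_distrib_left) (rule sum.swap)

lemma cinner_scale_right: "cinner a (c *s b) = c * cinner a b"
  unfolding cinner_def by (simp add: sum_distrib_left mult_ac)

lemma cinner_diff_right: "cinner a (b - c) = cinner a b - cinner a c"
  unfolding cinner_def by (simp add: sum_subtractf right_diff_distrib)

lemma cinner_commute: "cinner a b = cnj (cinner b a)"
  unfolding cinner_def by (simp add: mult.commute)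

lemma cinner_self: "cinner a a = of_real ((norm a)\<^sup>2)"
proof -
  have "(norm a)\<^sup>2 = (\<Sum>i\<in>UNIV. (cmod (a $ i))\<^sup>2)"
    by (simp add: norm_vec_def L2_set_def sum_nonneg)
  then show ?thesis
    by (simp only: cinner_def of_real_sum complex_norm_square mult.commute)
qed

lemma cinner_self_eq_0_iff: "cinner a a = 0 \<longleftrightarrow> a = 0"
  by (simp add: cinner_self)

text \<open>This is the matrix \<open>a b\<^sup>*\<close>, flattened to a vector indexed by pairs:
  \<open>cinner\<close> then becomes the Frobenius inner product, and the dimension theory of
  \<open>vec\<close> applies with dimension \<open>CARD('r)\<^sup>2\<close>.\<close>

definition outer :: "complex ^ 'r \<Rightarrow> complex ^ 'r \<Rightarrow> complex ^ ('r \<times> 'r)" where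
  "outer a b = (\<chi> p. a $ fst p * cnj (b $ snd p))"

lemma cinner_outer: "cinner (outer a b) (outer c d) = cinner a c * cinner d b"
  unfolding cinner_def outer_def
  by (simp add: UNIV_Times_UNIV[symmetric] sum.cartesian_product' sum_product
      del: UNIV_Times_UNIV) (simp add: mult_ac)

text \<open>The assumption is the system of normal equations for approximating \<open>A\<close> by
  combinations of the \<open>P v\<close>, hence the orthogonality. In \<open>cinner R R\<close> the
  subtracted combination then contributes nothing, so only \<open>cinner R A\<close> is left to
  expand.\<close>

lemma cinner_residual:
  fixes P :: "'a \<Rightarrow> complex ^ 'n"
  assumes "\<And>u. u \<in> C \<Longrightarrow> (\<Sum>v\<in>C. c v * cinner (P u) (P v)) = cinner (P u) A"
  defines "R \<equiv> A - (\<Sum>v\<in>C. c v *s P v)"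
  shows "\<And>u. u \<in> C \<Longrightarrow> cinner (P u) R = 0"
    and "cinner R R = cinner A A - (\<Sum>v\<in>C. c v * cnj (cinner (P v) A))"
proof -
  show orth: "cinner (P u) R = 0" if "u \<in> C" for u
    using assms(1)[OF that]
    by (simp add: R_def cinner_diff_right cinner_sum_right cinner_scale_right)
  have "cinner R R = cinner R A - (\<Sum>v\<in>C. c v * cinner R (P v))"
    by (subst (2) R_def) (simp add: cinner_diff_right cinner_sum_right cinner_scale_right)
  also have "(\<Sum>v\<in>C. c v * cinner R (P v)) = 0"
    by (intro sum.neutral ballI) (subst cinner_commute, simp add: orth)
  also have "cinner R A = cnj (cinner A R)"
    by (rule cinner_commute)
  also have "cinner A R = cinner A A - (\<Sum>v\<in>C. c v * cinner A (P v))"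
    by (simp add: R_def cinner_diff_right cinner_sum_right cinner_scale_right)
  also have "\<dots> = cinner A A - (\<Sum>v\<in>C. c v * cnj (cinner (P v) A))"
    by (subst (2) cinner_commute) (rule refl)
  finally have *: "cinner R R = cnj (cinner A A - (\<Sum>v\<in>C. c v * cnj (cinner (P v) A)))"
    by simp
  \<comment> \<open>The expansion produced the conjugate of the claimed value; this is harmless
    because \<open>cinner R R\<close> is real.\<close>
  have "cinner R R = cnj (cinner R R)" 
    by (rule cinner_commute)
  then show "cinner R R = cinner A A - (\<Sum>v\<in>C. c v * cnj (cinner (P v) A))"
    using * by simp
qed

section \<open>The projections of a code: Gram system, independence and spanning\<close>

locale code_setup =
  fixes \<alpha> :: real and C :: "(complex ^ 'r) set"
  assumes alpha_pos: "0 < \<alpha>" and alpha_less: "\<alpha> < 1" and code: "spherical_code \<alpha> C"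
begin

text \<open>The eigenvalue of \<open>(1 - \<alpha>\<^sup>2) I + \<alpha>\<^sup>2 J\<close>, of size
  \<open>card C\<close>, at the all-ones vector.\<close>

definition D :: real where "D = \<alpha>\<^sup>2 * real (card C) + 1 - \<alpha>\<^sup>2"

lemma finite_C: "finite C"
  using code by (simp add: spherical_code_def)

lemma alpha2_less: "\<alpha>\<^sup>2 < 1"
  using alpha_pos alpha_less by (simp add: power_less_one_iff abs_square_less_1)

lemma D_pos: "D > 0"
proof -
  have "0 \<le> \<alpha>\<^sup>2 * real (card C)" by simp
  then show ?thesis unfolding D_def using alpha2_less by linarith
qed

lemma norm_C: "u \<in> C \<Longrightarrow> norm u = 1"
  using code by (simp add: spherical_code_def)

lemma cmod_cinner:
  "u \<in> C \<Longrightarrow> v \<in> C \<Longrightarrow> (cmod (cinner u v))\<^sup>2 = \<alpha>\<^sup>2 + (if u = v then 1 - \<alpha>\<^sup>2 else 0)"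
  using code by (auto simp: spherical_code_def cinner_self)

lemma cinner_projections:
  assumes "u \<in> C" "v \<in> C"
  shows "cinner (outer u u) (outer v v) = of_real (\<alpha>\<^sup>2 + (if u = v then 1 - \<alpha>\<^sup>2 else 0))"
proof -
  have "cinner (outer u u) (outer v v) = cinner u v * cnj (cinner u v)"
    by (simp add: cinner_outer cinner_commute[of v u])
  then show ?thesis
    using cmod_cinner[OF assms] by (simp add: complex_norm_square[symmetric])
qed

lemma gram_projections:
  assumes "u \<in> C"
  shows "(\<Sum>v\<in>C. c v * cinner (outer u u) (outer v v))
    = of_real (\<alpha>\<^sup>2) * (\<Sum>v\<in>C. c v) + of_real (1 - \<alpha>\<^sup>2) * c u"
proof -
  have "(\<Sum>v\<in>C. c v * cinner (outer u u) (outer v v))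
     = (\<Sum>v\<in>C. of_real (\<alpha>\<^sup>2) * c v + (if u = v then of_real (1 - \<alpha>\<^sup>2) * c v else 0))"
    using assms by (intro sum.cong) (auto simp: cinner_projections algebra_simps)
  also have "\<dots> = of_real (\<alpha>\<^sup>2) * (\<Sum>v\<in>C. c v) + of_real (1 - \<alpha>\<^sup>2) * c u"
    using assms finite_C by (simp add: sum.distrib sum_distrib_left)
  finally show ?thesis .
qed

text \<open>Pairing the relation with each projection gives a homogeneous Gram system. Adding its
  equations yields \<open>D * s = 0\<close> for the coefficient sum \<open>s\<close>; once
  \<open>s\<close> vanishes, each single equation forces its own coefficient to vanish.\<close>

lemma projections_eq_0:
  assumes "(\<Sum>v\<in>C. c v *s outer v v) = 0" "u \<in> C"
  shows "c u = 0"
proof -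
  define s where "s = (\<Sum>v\<in>C. c v)"
  have eq: "of_real (\<alpha>\<^sup>2) * s + of_real (1 - \<alpha>\<^sup>2) * c v = 0" if "v \<in> C" for v
  proof -
    have "cinner (outer v v) (\<Sum>v\<in>C. c v *s outer v v) = 0"
      by (simp add: assms(1) cinner_def)
    then show ?thesis
      using gram_projections[OF that, of c] by (simp add: cinner_sum_right cinner_scale_right s_def)
  qed
  have "(\<Sum>v\<in>C. of_real (\<alpha>\<^sup>2) * s + of_real (1 - \<alpha>\<^sup>2) * c v) = 0"
    using eq by (intro sum.neutral) blast
  moreover have "(\<Sum>v\<in>C. of_real (\<alpha>\<^sup>2) * s + of_real (1 - \<alpha>\<^sup>2) * c v) = of_real D * s"
    by (simp only: sum.distrib sum_distrib_left[symmetric] s_def[symmetric] sum_constant)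
      (simp add: D_def algebra_simps)
  ultimately have "of_real D * s = 0"
    by simp
  then have "s = 0"
    using D_pos by simp
  then have "of_real (1 - \<alpha>\<^sup>2) * c u = 0"
    using eq[OF assms(2)] by simp
  then show ?thesis
    using alpha2_less by (simp only: mult_eq_0_iff of_real_eq_0_iff) auto
qed

lemma inj_on_projections: "inj_on (\<lambda>v. outer v v) C"
proof (rule inj_onI)
  fix u v assume uv: "u \<in> C" "v \<in> C" and eq: "outer u u = outer v v"
  have "cinner (outer u u) (outer v v) = cinner (outer u u) (outer u u)"
    using eq by simp
  then have "\<alpha>\<^sup>2 + (if u = v then 1 - \<alpha>\<^sup>2 else 0) = 1"
    using uv by (simp only: cinner_projections of_real_eq_iff) simp
  then show "u = v"
    using alpha2_less by (auto split: if_splits)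
qed

lemma independent_projections: "vec.independent ((\<lambda>v. outer v v) ` C)"
  unfolding vec.independent_explicit_finite_subsets
proof (intro allI impI ballI)
  fix S f b
  assume S: "S \<subseteq> (\<lambda>v. outer v v) ` C" "finite S" and 0: "(\<Sum>v\<in>S. f v *s v) = 0" and b: "b \<in> S"
  \<comment> \<open>The relation lives on an arbitrary subset \<open>S\<close> of the projections;
    its coefficients are pulled back to \<open>C\<close> and extended by zero.\<close>
  define c where "c v = (if outer v v \<in> S then f (outer v v) else 0)" for v
  have "(\<Sum>v\<in>C. c v *s outer v v) = (\<Sum>p\<in>(\<lambda>v. outer v v) ` C. (if p \<in> S then f p else 0) *s p)"
    by (simp add: sum.reindex[OF inj_on_projections] c_def)
  also have "\<dots> = (\<Sum>p\<in>S. f p *s p)"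
    using S finite_C by (intro sum.mono_neutral_cong_right) auto
  finally have *: "(\<Sum>v\<in>C. c v *s outer v v) = 0"
    using 0 by simp
  obtain u where "u \<in> C" "b = outer u u"
    using S b by auto
  then show "f b = 0"
    using projections_eq_0[OF *] b by (force simp: c_def)
qed

text \<open>The independent projections are as many as the dimension of the matrix space, so they
  span it. Thus \<open>R\<close> is a combination of vectors orthogonal to it, and
  \<open>cinner R R = 0\<close>.\<close>

lemma orthogonal_projections_eq_0:
  assumes "card C = CARD('r)\<^sup>2" and orth: "\<And>u. u \<in> C \<Longrightarrow> cinner (outer u u) R = 0"
  shows "R = 0"
proof -
  have "card ((\<lambda>v. outer v v) ` C) = CARD('r \<times> 'r)"
    using assms(1) by (simp add: card_image[OF inj_on_projections] power2_eq_square)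
  then have "R \<in> vec.span ((\<lambda>v. outer v v) ` C)"
    using vec.card_ge_dim_independent[OF subset_UNIV independent_projections]
    by (auto simp: card_cart_basis)
  then obtain c where "R = (\<Sum>p\<in>(\<lambda>v. outer v v) ` C. c p *s p)"
    using finite_C by (auto simp: vec.span_finite)
  then have "cinner R R = (\<Sum>p\<in>(\<lambda>v. outer v v) ` C. c p * cinner R p)"
    by (metis (no_types, lifting) cinner_sum_right cinner_scale_right sum.cong)
  also have "\<dots> = 0"
    by (intro sum.neutral ballI) (subst cinner_commute, auto simp: orth)
  finally show ?thesis
    by (simp add: cinner_self_eq_0_iff)
qed

text \<open>\<open>R\<close> is what remains of \<open>outer u w\<close> after projecting it onto
  the span of the \<open>outer v v\<close>. The numbers \<open>b v\<close> are its inner products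
  with these projections, and the subtracted term is the squared length of the projected
  part.\<close>

lemma residual_outer:
  fixes w :: "complex ^ 'r"
  assumes u: "u \<in> C"
  defines "b \<equiv> \<lambda>v. cinner v u * cinner w v"
  obtains R :: "complex ^ ('r \<times> 'r)" where
    "(norm R)\<^sup>2 = (norm w)\<^sup>2
      - ((\<Sum>v\<in>C. (cmod (b v))\<^sup>2) - \<alpha>\<^sup>2 / D * (cmod (\<Sum>v\<in>C. b v))\<^sup>2) / (1 - \<alpha>\<^sup>2)"
    "card C = CARD('r)\<^sup>2 \<Longrightarrow> R = 0"
proof -
  define s where "s = (\<Sum>v\<in>C. b v)"
  \<comment> \<open>This applies the inverse Gram matrix
    \<open>(I - (\<alpha>\<^sup>2 / D) J) / (1 - \<alpha>\<^sup>2)\<close> to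
    \<open>b\<close>.\<close>
  define c where "c v = (b v - of_real (\<alpha>\<^sup>2 / D) * s) / of_real (1 - \<alpha>\<^sup>2)" for v
  define R where "R = outer u w - (\<Sum>v\<in>C. c v *s outer v v)"
  have b: "cinner (outer v v) (outer u w) = b v" for v
    by (simp add: cinner_outer b_def)
  have nz: "complex_of_real (1 - \<alpha>\<^sup>2) \<noteq> 0" "complex_of_real D \<noteq> 0"
    using alpha2_less D_pos by (metis diff_gt_0_iff_gt less_irrefl of_real_eq_0_iff)+
  have "(\<Sum>v\<in>C. c v) = (s - of_nat (card C) * (of_real (\<alpha>\<^sup>2 / D) * s)) / of_real (1 - \<alpha>\<^sup>2)"
    by (simp add: c_def sum_divide_distrib[symmetric] sum_subtractf s_def)
  also have "s - of_nat (card C) * (of_real (\<alpha>\<^sup>2 / D) * s) = of_real (1 - \<alpha>\<^sup>2) * s / of_real D"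
  proof -
    have "s = s * of_real D / of_real D"
      using nz by simp
    then have "s - of_nat (card C) * (of_real (\<alpha>\<^sup>2 / D) * s)
        = (s * of_real D - of_nat (card C) * (of_real (\<alpha>\<^sup>2) * s)) / of_real D"
      by (simp add: diff_divide_distrib)
    also have "s * of_real D - of_nat (card C) * (of_real (\<alpha>\<^sup>2) * s) = of_real (1 - \<alpha>\<^sup>2) * s"
      by (simp add: D_def algebra_simps)
    finally show ?thesis .
  qed
  finally have sum_c: "(\<Sum>v\<in>C. c v) = s / of_real D"
    using nz by simp
  have gram: "(\<Sum>v\<in>C. c v * cinner (outer t t) (outer v v)) = cinner (outer t t) (outer u w)"
    if "t \<in> C" for t
    unfolding gram_projections[OF that] sum_c b using nz by (simp add: c_def)
  note res = cinner_residual[of C c "\<lambda>v. outer v v", OF gram, folded R_def]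
  have "(\<Sum>v\<in>C. c v * cnj (b v))
      = ((\<Sum>v\<in>C. b v * cnj (b v)) - of_real (\<alpha>\<^sup>2 / D) * (s * cnj s)) / of_real (1 - \<alpha>\<^sup>2)"
    by (simp add: c_def sum_divide_distrib[symmetric] sum_subtractf left_diff_distrib
        mult.assoc sum_distrib_left[symmetric] del: of_real_divide)
      (simp add: s_def)
  also have "\<dots> = of_real (((\<Sum>v\<in>C. (cmod (b v))\<^sup>2) - \<alpha>\<^sup>2 / D * (cmod s)\<^sup>2) / (1 - \<alpha>\<^sup>2))"
    by (simp add: complex_norm_square[symmetric])
  finally have sum_cb: "(\<Sum>v\<in>C. c v * cnj (b v)) = \<dots>" .
  have "cinner (outer u w) (outer u w) = of_real ((norm w)\<^sup>2)"
    unfolding cinner_outer by (simp add: cinner_self norm_C[OF u])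
  then have "complex_of_real ((norm R)\<^sup>2) = of_real ((norm w)\<^sup>2
      - ((\<Sum>v\<in>C. (cmod (b v))\<^sup>2) - \<alpha>\<^sup>2 / D * (cmod s)\<^sup>2) / (1 - \<alpha>\<^sup>2))"
    using res(2) unfolding b sum_cb cinner_self by simp
  then have "(norm R)\<^sup>2 = (norm w)\<^sup>2
      - ((\<Sum>v\<in>C. (cmod (b v))\<^sup>2) - \<alpha>\<^sup>2 / D * (cmod s)\<^sup>2) / (1 - \<alpha>\<^sup>2)"
    by (simp only: of_real_eq_iff)
  moreover have "R = 0" if "card C = CARD('r)\<^sup>2"
    using orthogonal_projections_eq_0[OF that] res(1) by blast
  ultimately show thesis
    using that unfolding s_def by blast
qed

text \<open>The slack \<open>e\<close> is a positive multiple of the squared residual of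
  \<open>outer u w\<close>: nonnegativity gives the inequality, a vanishing residual the equality.
  The multiple involves \<open>1 / L\<close>, so \<open>L\<close> must be positive.\<close>

lemma eigenvector_bound:
  fixes L :: real
  assumes u: "u \<in> C" and L: "L > 0"
    and w: "\<And>v. v \<in> C \<Longrightarrow> cinner v w = of_real L * x v" and norm_w: "(norm w)\<^sup>2 = L"
    and eig: "(\<Sum>v\<in>C. cinner u v * x v) = of_real L * x u"
    and x: "(\<Sum>v\<in>C. (cmod (x v))\<^sup>2) = 1"
  obtains e where "e \<ge> 0" "card C = CARD('r)\<^sup>2 \<Longrightarrow> e = 0"
    "L * (L\<^sup>2 / D - (1 - \<alpha>\<^sup>2) / \<alpha>\<^sup>2) * (cmod (x u))\<^sup>2 = L - (1 - \<alpha>\<^sup>2) / \<alpha>\<^sup>2 + e"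
proof -
  define b where "b v = cinner v u * cinner w v" for v
  define X where "X = (cmod (x u))\<^sup>2"
  obtain R :: "complex ^ ('r \<times> 'r)" where R: "(norm R)\<^sup>2 = (norm w)\<^sup>2
      - ((\<Sum>v\<in>C. (cmod (b v))\<^sup>2) - \<alpha>\<^sup>2 / D * (cmod (\<Sum>v\<in>C. b v))\<^sup>2) / (1 - \<alpha>\<^sup>2)"
    "card C = CARD('r)\<^sup>2 \<Longrightarrow> R = 0"
    using residual_outer[OF u, of w, folded b_def] by blast
  have b: "b v = cnj (cinner u v * (of_real L * x v))" if "v \<in> C" for v
    using w[OF that] by (simp add: b_def cinner_commute[of w v] cinner_commute[of v u])
  \<comment> \<open>One factor \<open>L\<close> comes from \<open>cinner v w\<close>; the
    eigenvector equation at \<open>u\<close> supplies the second.\<close>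
  have "(\<Sum>v\<in>C. b v) = cnj (of_real L * (\<Sum>v\<in>C. cinner u v * x v))"
    by (simp add: b sum_distrib_left mult_ac)
  then have "cmod (\<Sum>v\<in>C. b v) = L\<^sup>2 * cmod (x u)"
    using L by (simp add: eig norm_mult power2_eq_square)
  then have 1: "(cmod (\<Sum>v\<in>C. b v))\<^sup>2 = L^4 * X"
    by (simp add: X_def power_mult_distrib flip: power_mult)
  have "(cmod (b v))\<^sup>2 = L\<^sup>2 * (\<alpha>\<^sup>2 * (cmod (x v))\<^sup>2 + (if u = v then (1 - \<alpha>\<^sup>2) * X else 0))"
    if "v \<in> C" for v
  proof -
    have "(cmod (b v))\<^sup>2 = (cmod (cinner u v))\<^sup>2 * (L\<^sup>2 * (cmod (x v))\<^sup>2)"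
      by (simp add: b[OF that] norm_mult power_mult_distrib)
    then show ?thesis
      using cmod_cinner[OF u that] by (auto simp: X_def algebra_simps)
  qed
  then have "(\<Sum>v\<in>C. (cmod (b v))\<^sup>2)
      = L\<^sup>2 * (\<Sum>v\<in>C. \<alpha>\<^sup>2 * (cmod (x v))\<^sup>2 + (if u = v then (1 - \<alpha>\<^sup>2) * X else 0))"
    by (simp add: sum_distrib_left)
  also have "\<dots> = L\<^sup>2 * (\<alpha>\<^sup>2 + (1 - \<alpha>\<^sup>2) * X)"
    using u finite_C by (simp add: sum.distrib sum_distrib_left[symmetric] x)
  finally have 2: "(\<Sum>v\<in>C. (cmod (b v))\<^sup>2) = L\<^sup>2 * (\<alpha>\<^sup>2 + (1 - \<alpha>\<^sup>2) * X)" .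
  \<comment> \<open>The scaling turns the term \<open>\<alpha>\<^sup>2\<close> of the sum marked
    \<open>2\<close> into \<open>- L\<close>, which cancels the \<open>L\<close> of the
    bound.\<close>
  define e where "e = (1 - \<alpha>\<^sup>2) / (\<alpha>\<^sup>2 * L) * (norm R)\<^sup>2"
  have nz: "1 - \<alpha>\<^sup>2 \<noteq> 0" "\<alpha>\<^sup>2 \<noteq> 0"
    using alpha2_less alpha_pos by auto
  \<comment> \<open>With \<open>a\<close> for \<open>\<alpha>\<^sup>2\<close> and \<open>q\<close>
    for \<open>1 - \<alpha>\<^sup>2\<close> as atoms, clearing denominators is a plain field
    computation.\<close>
  have algebra: "L * (L\<^sup>2 / D - q / a) * X
      = L - q / a + q / (a * L) * (L - (L\<^sup>2 * (a + q * X) - a / D * (L^4 * X)) / q)"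
    if "q \<noteq> 0" "a \<noteq> 0" for a q
    using that L D_pos by (simp add: field_simps power2_eq_square power4_eq_xxxx)
  show thesis
  proof (rule that)
    show "e \<ge> 0" 
      using L alpha2_less by (simp add: e_def)
    show "e = 0" if "card C = CARD('r)\<^sup>2" 
      using R(2)[OF that] by (simp add: e_def)
    show "L * (L\<^sup>2 / D - (1 - \<alpha>\<^sup>2) / \<alpha>\<^sup>2) * (cmod (x u))\<^sup>2 = L - (1 - \<alpha>\<^sup>2) / \<alpha>\<^sup>2 + e"
      unfolding e_def R(1) 1 2 norm_w X_def[symmetric] by (rule algebra[OF nz])
  qed
qed

end

theorem theorem2p3:
  fixes \<alpha> :: real and C :: "(complex ^ 'r) set" and lam :: complex and x :: "complex ^ 'r \<Rightarrow> complex"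
  assumes "0 < \<alpha>" and "\<alpha> < 1"
    and "spherical_code \<alpha> C"
    and "eigenvector_on C gram_matrix lam x"
    and "unit_vector_on C x"
  shows "lam \<in> \<real> \<and>
    (\<forall>u\<in>C.
      Re lam * ((Re lam)\<^sup>2 / (\<alpha>\<^sup>2 * real (card C) + 1 - \<alpha>\<^sup>2) - (1 - \<alpha>\<^sup>2) / \<alpha>\<^sup>2) * (cmod (x u))\<^sup>2
        \<ge> Re lam - (1 - \<alpha>\<^sup>2) / \<alpha>\<^sup>2) \<and>
    (card C = CARD('r)\<^sup>2 \<and> lam \<noteq> 0 \<longrightarrow>
      (\<forall>u\<in>C.
        Re lam * ((Re lam)\<^sup>2 / (\<alpha>\<^sup>2 * real (card C) + 1 - \<alpha>\<^sup>2) - (1 - \<alpha>\<^sup>2) / \<alpha>\<^sup>2) * (cmod (x u))\<^sup>2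
          = Re lam - (1 - \<alpha>\<^sup>2) / \<alpha>\<^sup>2))"
proof -
  interpret code: code_setup \<alpha> C
    using assms(1-3) by unfold_locales
  define w where "w = (\<Sum>v\<in>C. x v *s v)"
  have eig: "(\<Sum>v\<in>C. cinner u v * x v) = lam * x u" if "u \<in> C" for u
    using assms(4) that by (simp add: eigenvector_on_def gram_matrix_def)
  have x: "(\<Sum>v\<in>C. (cmod (x v))\<^sup>2) = 1"
    using assms(5) by (simp add: unit_vector_on_def)
  have w: "cinner u w = lam * x u" if "u \<in> C" for u
    using eig[OF that] by (simp add: w_def cinner_sum_right cinner_scale_right mult.commute)
  \<comment> \<open>Since \<open>x\<close> is a unit vector, expanding \<open>cinner w w\<close>
    shows that \<open>lam\<close> is the squared norm of \<open>w\<close>, hence real and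
    nonnegative.\<close>
  have "cinner w w = (\<Sum>v\<in>C. x v * cinner w v)"
    by (subst (2) w_def) (simp add: cinner_sum_right cinner_scale_right)
  also have "\<dots> = (\<Sum>v\<in>C. cnj lam * (x v * cnj (x v)))"
    by (intro sum.cong refl) (simp add: cinner_commute[of w] w mult_ac)
  also have "\<dots> = cnj lam * of_real (\<Sum>v\<in>C. (cmod (x v))\<^sup>2)"
    by (simp only: sum_distrib_left of_real_sum complex_norm_square)
  finally have "cnj lam = of_real ((norm w)\<^sup>2)"
    by (simp add: x cinner_self)
  then have lam: "lam = of_real ((norm w)\<^sup>2)"
    by (metis complex_cnj_cnj complex_cnj_complex_of_real)
  define L where "L = (norm w)\<^sup>2"
  have bound: "\<exists>e\<ge>0. (card C = CARD('r)\<^sup>2 \<longrightarrow> e = 0) \<and>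
      L * (L\<^sup>2 / code.D - (1 - \<alpha>\<^sup>2) / \<alpha>\<^sup>2) * (cmod (x u))\<^sup>2 = L - (1 - \<alpha>\<^sup>2) / \<alpha>\<^sup>2 + e"
    if "u \<in> C" "L > 0" for u
  proof (rule code.eigenvector_bound[of u L w x])
    show "cinner v w = of_real L * x v" if "v \<in> C" for v
      using w[OF that] lam by (simp add: L_def)
    show "(\<Sum>v\<in>C. cinner u v * x v) = of_real L * x u"
      using eig[OF that(1)] lam by (simp add: L_def)
  qed (use that x L_def in auto)
  show ?thesis
  proof (cases "L = 0")
    \<comment> \<open>For \<open>lam = 0\<close> the inequality reads
      \<open>0 \<ge> - (1 - \<alpha>\<^sup>2) / \<alpha>\<^sup>2\<close>. It is strict, which is why
      the equality clause excludes this eigenvalue.\<close>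
    case True
    then show ?thesis
      using lam code.alpha2_less by (simp add: L_def)
  next
    case False
    then have "L > 0"
      by (simp add: L_def)
    note bound = bound[OF _ this]
    have "lam \<in> \<real>" "Re lam = L"
      using lam by (simp_all add: L_def)
    moreover have "L * (L\<^sup>2 / code.D - (1 - \<alpha>\<^sup>2) / \<alpha>\<^sup>2) * (cmod (x u))\<^sup>2 \<ge> L - (1 - \<alpha>\<^sup>2) / \<alpha>\<^sup>2"
      if "u \<in> C" for u
      using bound[OF that] by linarith
    moreover have "L * (L\<^sup>2 / code.D - (1 - \<alpha>\<^sup>2) / \<alpha>\<^sup>2) * (cmod (x u))\<^sup>2 = L - (1 - \<alpha>\<^sup>2) / \<alpha>\<^sup>2"
      if "u \<in> C" "card C = CARD('r)\<^sup>2" for u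
      using bound[OF that(1)] that(2) by auto
    ultimately show ?thesis
      unfolding code.D_def[symmetric] by blast
  qed
qed

end
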